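(* Let $n\in\mathbb N_0$ and $b,c,d,e,f,q\in\mathbb C^*$ with $|q|\ne1$. Then (whenever no denominator occurring vanishes) $${}_4\phi_3\left(q^{-n},\frac{qb}{ef},c,d;\,\frac{q^{-n}cd}b,\frac{qb}e,\frac{qb}f;\,q,q\right)$$ $$=\frac{\left(\frac{qb}{de},\frac{qb}c;q\right)_n}{\left(\frac{qb}{cd},\frac{qb}e;q\right)_n}\,{}_4\phi_3\left(q^{-n},\frac{qb}{cf},d,e;\,\frac{q^{-n}de}b,\frac{qb}c,\frac{qb}f;\,q,q\right)$$ $$=\frac{\left(\frac{qb}{df},\frac{qb}c;q\right)_n}{\left(\frac{qb}{cd},\frac{qb}f;q\right)_n}\,{}_4\phi_3\left(q^{-n},\frac{qb}{ce},d,f;\,\frac{q^{-n}df}b,\frac{qb}c,\frac{qb}e;\,q,q\right)$$ $$=\frac{\left(\frac{qb}{ce},\frac{qb}d;q\right)_n}{\left(\frac{qb}{cd},\frac{qb}e;q\right)_n}\,{}_4\phi_3\left(q^{-n},\frac{qb}{df},c,e;\,\frac{q^{-n}ce}b,\frac{qb}d,\frac{qb}f;\,q,q\right)$$ $$=\frac{\left(\frac{qb}{cf},\frac{qb}d;q\right)_n}{\left(\frac{qb}{cd},\frac{qb}f;q\right)_n}\,{}_4\phi_3\left(q^{-n},\frac{qb}{de},c,f;\,\frac{q^{-n}cf}b,\frac{qb}d,\frac{qb}e;\,q,q\right)$$ $$=\frac{\left(\frac{qb}{ef},\frac{qb}c,\frac{qb}d;q\right)_n}{\left(\frac{qb}{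cd},\frac{qb}e,\frac{qb}f;q\right)_n}\,{}_4\phi_3\left(q^{-n},\frac{qb}{cd},e,f;\,\frac{q^{-n}ef}b,\frac{qb}c,\frac{qb}d;\,q,q\right).$$
   Context: $\mathbb N_0=\{0,1,2,\ldots\}$, $\mathbb C^*=\mathbb C\setminus\{0\}$; $e$ is a parameter, not Euler's number. The $q$-Pochhammer symbol is $(a;q)_n=(1-a)(1-aq)\cdots(1-aq^{n-1})$ (empty product equal to $1$), and $(a_1,\ldots,a_k;q)_n=(a_1;q)_n\cdots(a_k;q)_n$. The terminating series is $${}_4\phi_3(q^{-n},\alpha,\beta,\gamma;\,\delta,\epsilon,\zeta;\,q,z)=\sum_{k=0}^n\frac{(q^{-n},\alpha,\beta,\gamma;q)_k}{(q,\delta,\epsilon,\zeta;q)_k}z^k.$$ Standing convention: denominator parameters of a terminating series avoid $\{q^{-k}:0\le k\le n-1\}$, so that no denominator vanishes. *)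

theory Defs
  imports Complex_Main
begin

definition qpoch :: "complex \<Rightarrow> complex \<Rightarrow> nat \<Rightarrow> complex" where
  "qpoch a q n = (\<Prod>i<n. 1 - a * q ^ i)"

definition qpochs :: "complex list \<Rightarrow> complex \<Rightarrow> nat \<Rightarrow> complex" where
  "qpochs as q n = (\<Prod>a\<leftarrow>as. qpoch a q n)"

text \<open>
  The terminating series with upper parameters \<open>q\<^sup>-\<^sup>n, \<alpha>, \<beta>, \<gamma>\<close>: the first upper parameter is
  always \<open>q\<^sup>-\<^sup>n\<close> and is represented by the argument \<open>n\<close>.
\<close>

definition phi43 ::
  "nat \<Rightarrow> complex \<Rightarrow> complex \<Rightarrow> complex \<Rightarrow> complex \<Rightarrow> complex \<Rightarrow> complex \<Rightarrow> complex \<Rightarrow> complex \<Rightarrow> complex" where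
  "phi43 n \<alpha> \<beta> \<gamma> \<delta> \<epsilon> \<zeta> q z =
     (\<Sum>k\<le>n. qpochs [q powi (- int n), \<alpha>, \<beta>, \<gamma>] q k / qpochs [q, \<delta>, \<epsilon>, \<zeta>] q k * z ^ k)"

text \<open>
  The convention on a denominator parameter \<open>x\<close> of a series terminating at \<open>n\<close>; for \<open>q \<noteq> 0\<close> it
  says that \<^term>\<open>qpoch x q k\<close> is nonzero for all \<open>k \<le> n\<close>.
\<close>

definition denom_ok :: "complex \<Rightarrow> nat \<Rightarrow> complex \<Rightarrow> bool" where
  "denom_ok q n x \<longleftrightarrow> x \<notin> {q powi (- int k) |k. k < n}"

end

theory Submission
  imports Defs
begin

text \<open>
  Put \<open>a = qb\<close> and multiply the first series by the three \<open>q\<close>-Pochhammer symbols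
  \<open>(a/(cd), a/e, a/f; q)\<^sub>n\<close>. All denominators cancel, and what remains is the finite sum
  \<open>balanced_sum\<close>, a function of \<open>c, d, e, f\<close>. The same multiplication turns each of the other
  five series, together with its prefactor, into this sum with the four letters permuted. The
  theorem thus follows from the symmetry of \<open>balanced_sum\<close> in \<open>c, d, e, f\<close>.

  By its definition the sum is invariant under the exchanges of \<open>c\<close> with \<open>d\<close> and of \<open>e\<close> with \<open>f\<close>.
  To mix the two pairs, rewrite it with the \<open>q\<close>-Saalschuetz summation: this sum evaluates a product
  of two Pochhammer symbols, so a factor \<open>(a/(cd); q)\<^sub>n\<^sub>-\<^sub>k (aq\<^sup>k/e; q)\<^sub>n\<^sub>-\<^sub>k\<close> can be expanded by it.
  After an exchange of summations the inner sum is again of Saalschuetz type and can be evaluated.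
  The resulting single sum (\<open>balanced_sum_alt\<close>) is visibly symmetric in \<open>c, d, e\<close>.
  Together with the exchange of \<open>e\<close> and \<open>f\<close> this generates all permutations.

  The \<open>q\<close>-Saalschuetz summation itself is proved in polynomial form by induction on its length;
  the induction step combines the two Pascal recurrences of the \<open>q\<close>-binomial coefficients.
  Both sums are kept cleared of denominators, so every parameter is treated at once, special values
  included. The \<open>q\<close>-binomial coefficients in them are quotients of symbols \<open>(q; q)\<^sub>m\<close>, which are
  nonzero because \<open>\<bar>q\<bar> \<noteq> 1\<close> prevents \<open>q\<close> from being a root of unity.
\<close>

section \<open>Pochhammer symbols and q-binomial coefficients\<close>

lemma qpoch_0 [simp]: "qpoch a q 0 = 1"
  by (simp add: qpoch_def)

lemma qpoch_Suc: "qpoch a q (Suc n) = qpoch a q n * (1 - a * q ^ n)"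
  by (simp add: qpoch_def)

lemma qpoch_add: "qpoch a q (m + n) = qpoch a q m * qpoch (a * q ^ m) q n"
  by (induction n) (simp_all add: qpoch_Suc power_add mult.assoc)

lemma qpoch_Suc_left: "qpoch a q (Suc n) = (1 - a) * qpoch (a * q) q n"
  using qpoch_add[of a q 1 n] by (simp add: qpoch_Suc)

lemma qpoch_q_nonzero:
  assumes "\<And>m. m > 0 \<Longrightarrow> q ^ m \<noteq> 1"
  shows "qpoch q q n \<noteq> 0"
proof -
  have "1 - q * q ^ i \<noteq> 0" for i
    using assms[of "Suc i"] by simp
  then show ?thesis
    by (simp add: qpoch_def)
qed

lemma qpoch_nonzero_if_denom_ok:
  assumes "denom_ok q n x" "q \<noteq> 0" "k \<le> n"
  shows "qpoch x q k \<noteq> 0"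
proof
  assume "qpoch x q k = 0"
  then obtain i where i: "i < k" "x * q ^ i = 1"
    by (auto simp: qpoch_def)
  then have "x = q powi (- int i)"
    using assms(2) by (simp add: power_int_minus field_simps)
  then show False
    using assms i(1) by (auto simp: denom_ok_def)
qed

text \<open>
  The power of \<open>q\<close> produced by reversing the factors does not depend on \<open>A\<close>. It is therefore kept as
  an unevaluated product: it cancels when the lemma is used for two values of \<open>A\<close>.
\<close>

lemma qpoch_reverse:
  assumes "q \<noteq> 0" "A \<noteq> 0" "k \<le> n"
  shows "qpoch A q n =
    qpoch A q (n - k) * A ^ k * (\<Prod>i<k. - (q ^ (n - 1 - i))) * qpoch (q powi (- int n) * q / A) q k"
  using assms(3)
proof (induction k)
  case (Suc k)
  obtain m where n: "n = Suc (m + k)"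
    using Suc.prems by (metis add.commute add_Suc_right le_Suc_ex add_Suc)
  have "q powi (- int n) * q ^ n = 1"
    using assms(1) by (simp add: power_int_minus)
  then have "q powi (- int n) * q * q ^ k * q ^ m = 1"
    by (simp add: n power_add mult_ac del: of_nat_Suc of_nat_add)
  then have "1 - A * q ^ m = A * (- (q ^ m)) * (1 - q powi (- int n) * q / A * q ^ k)"
    using assms(2) by (simp add: field_simps)
  moreover have "n - k = Suc m" "n - Suc k = m" "n - 1 - k = m"
    by (simp_all add: n)
  ultimately show ?case
    using Suc by (simp add: qpoch_Suc)
qed simp

definition qbinomial :: "complex \<Rightarrow> nat \<Rightarrow> nat \<Rightarrow> complex" where
  "qbinomial q n k = (if k \<le> n then qpoch q q n / (qpoch q q k * qpoch q q (n - k)) else 0)"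

context
  fixes q :: complex
  assumes nonroot: "\<And>m. m > 0 \<Longrightarrow> q ^ m \<noteq> 1"
begin

lemma qbinomial_0 [simp]: "qbinomial q n 0 = 1"
  by (simp add: qbinomial_def qpoch_q_nonzero nonroot)

lemma qbinomial_self [simp]: "qbinomial q n n = 1"
  by (simp add: qbinomial_def qpoch_q_nonzero nonroot)

text \<open>
  With \<open>Y = (1 - q\<^sup>j\<^sup>+\<^sup>1)\<close> and \<open>Z = (1 - q\<^sup>m\<^sup>+\<^sup>1)\<close>, the two Pascal recurrences come from the two ways
  to write \<open>1 - q\<^sup>j\<^sup>+\<^sup>m\<^sup>+\<^sup>2\<close> as \<open>Z + q\<^sup>m\<^sup>+\<^sup>1 Y\<close> and as \<open>q\<^sup>j\<^sup>+\<^sup>1 Z + Y\<close>.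
\<close>

lemma qbinomial_pascal:
  shows "qbinomial q (Suc (Suc (j + m))) (Suc j) =
      qbinomial q (Suc (j + m)) (Suc j) + q ^ Suc m * qbinomial q (Suc (j + m)) j" (is ?left)
    and "qbinomial q (Suc (Suc (j + m))) (Suc j) =
      q ^ Suc j * qbinomial q (Suc (j + m)) (Suc j) + qbinomial q (Suc (j + m)) j" (is ?right)
proof -
  define Q where "Q = qpoch q q (Suc (j + m)) / (qpoch q q (Suc j) * qpoch q q (Suc m))"
  have nz: "qpoch q q i \<noteq> 0" "1 - q * q ^ i \<noteq> 0" for i
    using qpoch_q_nonzero[OF nonroot] nonroot[of "Suc i"] by auto
  have top: "qbinomial q (Suc (Suc (j + m))) (Suc j) = Q * (1 - q ^ Suc (Suc (j + m)))"
    by (simp add: qbinomial_def Q_def Suc_diff_le qpoch_Suc)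
  have right: "qbinomial q (Suc (j + m)) (Suc j) = Q * (1 - q ^ Suc m)"
    using nz by (simp add: qbinomial_def Q_def Suc_diff_le qpoch_Suc[of q q m])
  have left: "qbinomial q (Suc (j + m)) j = Q * (1 - q ^ Suc j)"
    using nz by (simp add: qbinomial_def Q_def Suc_diff_le qpoch_Suc[of q q j])
  show ?left ?right
    unfolding top left right by (simp_all add: power_add algebra_simps)
qed

lemma qbinomial_trinomial:
  "qbinomial q (k + j + m) k * qbinomial q (j + m) j =
   qbinomial q (k + j + m) (k + j) * qbinomial q (k + j) k"
  using qpoch_q_nonzero[OF nonroot] by (simp add: qbinomial_def add.assoc)

section \<open>The q-Saalschuetz summation\<close>

text \<open>
  This is the evaluation of the balanced \<open>\<^sub>3\<phi>\<^sub>2(q\<^sup>-\<^sup>n, x, y; z, q\<^sup>1\<^sup>-\<^sup>nxy/z; q, q)\<close> with \<open>z = xyA\<close>,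
  multiplied by \<open>(z, A; q)\<^sub>n\<close>; in this form it is a polynomial identity in \<open>x, y, A\<close>.

  Let \<open>t n j\<close> be the summand. The recurrence \<open>[n+1, j+1] = [n, j+1] + q\<^sup>n\<^sup>-\<^sup>j [n, j]\<close>, minus \<open>zq\<^sup>n\<close> times
  the other Pascal recurrence, splits \<open>t (n+1) (j+1)\<close> into a multiple of \<open>t n (j+1)\<close> and one of \<open>t n j\<close>.
  Collecting the two multiples of each \<open>t n j\<close> gives the factor \<open>(1 - xAq\<^sup>n)(1 - yAq\<^sup>n)\<close>,
  independent of \<open>j\<close>.
\<close>

lemma q_saalschuetz:
  "(\<Sum>j\<le>n. qbinomial q n j * A ^ j * qpoch x q j * qpoch y q j
      * qpoch A q (n - j) * qpoch (x * y * A * q ^ j) q (n - j))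
    = qpoch (x * A) q n * qpoch (y * A) q n"
proof (induction n)
  case (Suc n)
  define z where "z = x * y * A"
  define t where "t n j = qbinomial q n j * A ^ j * qpoch x q j * qpoch y q j
      * qpoch A q (n - j) * qpoch (z * q ^ j) q (n - j)" for n j
  define P where "P j = t n j * ((1 - A * q ^ (n - j)) * (1 - z * q ^ (n + j)))" for j
  define Q where "Q j = t n j * (q ^ (n - j) * A * (1 - x * q ^ j) * (1 - y * q ^ j))" for j
  have first: "t (Suc n) 0 = P 0"
    by (simp add: t_def P_def qpoch_Suc)
  have middle: "t (Suc n) (Suc j) = P (Suc j) + Q j" if "j < n" for j
  proof -
    obtain m where n: "n = Suc (j + m)"
      using \<open>j < n\<close> less_iff_Suc_add by auto
    define B where "B = A ^ Suc j * qpoch x q (Suc j) * qpoch y q (Suc j)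
      * qpoch A q (Suc m) * qpoch (z * q ^ Suc j) q m"
    have "qpoch (z * q ^ j) q (Suc m) = (1 - z * q ^ j) * qpoch (z * q ^ Suc j) q m"
      by (simp add: qpoch_Suc_left mult.commute mult.left_commute)
    then have "Q j = B * (qbinomial q n j * (q ^ Suc m * (1 - z * q ^ j)))"
      by (simp add: Q_def t_def B_def n Suc_diff_le qpoch_Suc[of x] qpoch_Suc[of y])
    moreover have "P (Suc j) = B * (qbinomial q n (Suc j) * (1 - z * q ^ (n + Suc j)))"
      by (simp add: P_def t_def B_def n qpoch_Suc[of A])
    moreover have "t (Suc n) (Suc j) = B * (qbinomial q (Suc n) (Suc j) * (1 - z * q ^ n))"
    proof -
      have "qpoch (z * q ^ Suc j) q (Suc m) = qpoch (z * q ^ Suc j) q m * (1 - z * q ^ n)"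
        by (simp add: qpoch_Suc n power_add mult_ac)
      moreover have "Suc n - Suc j = Suc m"
        by (simp add: n)
      ultimately show ?thesis
        by (simp only: t_def B_def mult_ac)
    qed
    moreover have "qbinomial q (Suc n) (Suc j) * (1 - z * q ^ n)
      = qbinomial q n (Suc j) * (1 - z * q ^ (n + Suc j))
        + qbinomial q n j * (q ^ Suc m * (1 - z * q ^ j))"
    proof -
      have "qbinomial q (Suc n) (Suc j) * (1 - z * q ^ n)
        = qbinomial q (Suc n) (Suc j) - z * q ^ n * qbinomial q (Suc n) (Suc j)"
        by (simp add: algebra_simps)
      also have "\<dots> = (qbinomial q n (Suc j) + q ^ Suc m * qbinomial q n j)
          - z * q ^ n * (q ^ Suc j * qbinomial q n (Suc j) + qbinomial q n j)"
        unfolding n by (metis qbinomial_pascal)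
      also have "\<dots> = qbinomial q n (Suc j) * (1 - z * q ^ (n + Suc j))
        + qbinomial q n j * (q ^ Suc m * (1 - z * q ^ j))"
        by (simp add: n power_add algebra_simps)
      finally show ?thesis .
    qed
    ultimately show ?thesis
      by (simp add: distrib_left)
  qed
  have last: "t (Suc n) (Suc n) = Q n"
    by (simp add: t_def Q_def qpoch_Suc)
  have collect: "P j + Q j = (1 - x * A * q ^ n) * (1 - y * A * q ^ n) * t n j" if "j \<le> n" for j
  proof -
    obtain m where "n = j + m"
      using \<open>j \<le> n\<close> le_Suc_ex by blast
    then show ?thesis
      by (simp add: P_def Q_def z_def power_add algebra_simps)
  qed
  have "(\<Sum>j\<le>Suc n. t (Suc n) j) = t (Suc n) 0 + ((\<Sum>j<n. t (Suc n) (Suc j)) + t (Suc n) (Suc n))"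
    unfolding sum.atMost_Suc_shift by (simp flip: lessThan_Suc_atMost)
  also have "\<dots> = (P 0 + (\<Sum>j<n. P (Suc j))) + ((\<Sum>j<n. Q j) + Q n)"
    by (simp add: first middle last sum.distrib)
  also have "\<dots> = (\<Sum>j\<le>n. P j) + (\<Sum>j\<le>n. Q j)"
    unfolding sum.atMost_shift[of P] by (simp flip: lessThan_Suc_atMost)
  also have "\<dots> = (1 - x * A * q ^ n) * (1 - y * A * q ^ n) * (\<Sum>j\<le>n. t n j)"
    by (simp add: collect sum_distrib_left flip: sum.distrib)
  also have "(\<Sum>j\<le>n. t n j) = qpoch (x * A) q n * qpoch (y * A) q n"
    using Suc.IH by (simp add: t_def z_def)
  finally show ?case
    by (simp add: t_def z_def qpoch_Suc mult_ac)
qed simp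

section \<open>The symmetric function behind the transformations\<close>

definition balanced_sum :: "nat \<Rightarrow> complex \<Rightarrow> complex \<Rightarrow> complex \<Rightarrow> complex \<Rightarrow> complex \<Rightarrow> complex" where
  "balanced_sum n a c d e f =
    (\<Sum>k\<le>n. qbinomial q n k * (a / (c * d)) ^ k
       * qpoch (a / (e * f)) q k * qpoch c q k * qpoch d q k
       * qpoch (a / (c * d)) q (n - k) * qpoch (a / e * q ^ k) q (n - k)
       * qpoch (a / f * q ^ k) q (n - k))"

lemma balanced_sum_swap_left: "balanced_sum n a c d e f = balanced_sum n a d c e f"
  by (simp add: balanced_sum_def mult_ac)

lemma balanced_sum_swap_right: "balanced_sum n a c d e f = balanced_sum n a c d f e"
  by (simp add: balanced_sum_def mult_ac)

text \<open>
  The parameters of the first Saalschuetz expansion are chosen such that \<open>A = f\<close> and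
  \<open>y = aq\<^sup>k/(ef)\<close>: then \<open>(y; q)\<^sub>j\<close> merges with the factor \<open>(a/(ef); q)\<^sub>k\<close> of the sum into
  \<open>(a/(ef); q)\<^sub>k\<^sub>+\<^sub>j\<close>. With \<open>N = k + j\<close> as the new outer index, the inner sum over \<open>k\<close> is the
  Saalschuetz sum with \<open>x = c\<close>, \<open>y = d\<close>, \<open>A = a/(cdf)\<close>.
\<close>

lemma balanced_sum_alt:
  assumes "c \<noteq> 0" "d \<noteq> 0" "e \<noteq> 0" "f \<noteq> 0"
  shows "balanced_sum n a c d e f =
    (\<Sum>N\<le>n. qbinomial q n N * f ^ N
       * qpoch (a / (c * f)) q N * qpoch (a / (d * f)) q N * qpoch (a / (e * f)) q N
       * qpoch f q (n - N) * qpoch (a / f * q ^ N) q (n - N)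
       * qpoch (a\<^sup>2 / (c * d * e * f) * q ^ N) q (n - N))"
proof -
  define A where "A = a / (c * d * f)"
  define R where "R N = qpoch (a / (e * f)) q N * qpoch f q (n - N)
    * qpoch (a / f * q ^ N) q (n - N) * qpoch (a\<^sup>2 / (c * d * e * f) * q ^ N) q (n - N)" for N
  define g where "g k j = qbinomial q n (k + j) * R (k + j) * f ^ (k + j)
    * (qbinomial q (k + j) k * A ^ k * qpoch c q k * qpoch d q k
       * qpoch A q j * qpoch (a / f * q ^ k) q j)" for k j
  have expand: "qbinomial q n k * (a / (c * d)) ^ k
       * qpoch (a / (e * f)) q k * qpoch c q k * qpoch d q k
       * qpoch (a / (c * d)) q (n - k) * qpoch (a / e * q ^ k) q (n - k)
       * qpoch (a / f * q ^ k) q (n - k) = (\<Sum>j\<le>n - k. g k j)" (is "?lhs = _")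
    if "k \<le> n" for k
  proof -
    define y where "y = a / (e * f) * q ^ k"
    define C where "C = qbinomial q n k * (a / (c * d)) ^ k
       * qpoch (a / (e * f)) q k * qpoch c q k * qpoch d q k * qpoch (a / f * q ^ k) q (n - k)"
    have "A * f = a / (c * d)" "y * f = a / e * q ^ k"
      using assms by (simp_all add: A_def y_def)
    then have "?lhs = C * (qpoch (A * f) q (n - k) * qpoch (y * f) q (n - k))"
      by (simp add: C_def mult_ac)
    also have "\<dots> = (\<Sum>j\<le>n - k. C * (qbinomial q (n - k) j * f ^ j * qpoch A q j * qpoch y q j
      * qpoch f q (n - k - j) * qpoch (A * y * f * q ^ j) q (n - k - j)))"
      by (simp only: q_saalschuetz flip: sum_distrib_left)
    also have "\<dots> = (\<Sum>j\<le>n - k. g k j)"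
    proof (rule sum.cong[OF refl])
      fix j assume "j \<in> {..n - k}"
      with \<open>k \<le> n\<close> obtain m where n: "n = k + j + m"
        by (metis atMost_iff le_Suc_ex add.assoc ordered_cancel_comm_monoid_diff_class.add_diff_inverse)
      have "n - k = j + m" "n - k - j = m" "n - (k + j) = m"
        by (simp_all add: n)
      note idx = this
      have 1: "qpoch (a / f * q ^ k) q (j + m)
          = qpoch (a / f * q ^ k) q j * qpoch (a / f * q ^ (k + j)) q m"
        by (simp add: qpoch_add power_add mult.assoc)
      have 2: "qpoch (a / (e * f)) q (k + j) = qpoch (a / (e * f)) q k * qpoch y q j"
        by (simp add: qpoch_add y_def)
      have 3: "A * y * f * q ^ j = a\<^sup>2 / (c * d * e * f) * q ^ (k + j)"
        using assms by (simp add: A_def y_def power_add power2_eq_square mult_ac)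
      have 4: "(a / (c * d)) ^ k * f ^ j = f ^ (k + j) * A ^ k"
        using assms by (simp add: A_def power_add power_divide power_mult_distrib)
      have 5: "qbinomial q n k * qbinomial q (j + m) j = qbinomial q n (k + j) * qbinomial q (k + j) k"
        unfolding n by (rule qbinomial_trinomial)
      have "C * (qbinomial q (j + m) j * f ^ j * qpoch A q j * qpoch y q j
            * qpoch f q m * qpoch (A * y * f * q ^ j) q m)
          = (qbinomial q n k * qbinomial q (j + m) j) * ((a / (c * d)) ^ k * f ^ j)
            * (qpoch (a / (e * f)) q k * qpoch y q j) * qpoch (a / f * q ^ k) q (j + m)
            * qpoch c q k * qpoch d q k * qpoch A q j
            * qpoch f q m * qpoch (A * y * f * q ^ j) q m"
        by (simp only: C_def idx mult_ac)
      also have "\<dots> = g k j"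
        unfolding 1 2[symmetric] 3 4 5 g_def R_def idx by (simp only: mult_ac)
      finally show "C * (qbinomial q (n - k) j * f ^ j * qpoch A q j * qpoch y q j
            * qpoch f q (n - k - j) * qpoch (A * y * f * q ^ j) q (n - k - j)) = g k j"
        unfolding idx diff_add_inverse .
    qed
    finally show ?thesis .
  qed
  have collapse: "(\<Sum>k\<le>N. g k (N - k))
      = qbinomial q n N * R N * f ^ N * (qpoch (a / (c * f)) q N * qpoch (a / (d * f)) q N)" for N
  proof -
    have "c * d * A = a / f" "c * A = a / (d * f)" "d * A = a / (c * f)"
      using assms by (simp_all add: A_def)
    then have "(\<Sum>k\<le>N. qbinomial q N k * A ^ k * qpoch c q k * qpoch d q k
       * qpoch A q (N - k) * qpoch (a / f * q ^ k) q (N - k))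
      = qpoch (a / (c * f)) q N * qpoch (a / (d * f)) q N"
      using q_saalschuetz[where n = N and A = A and x = c and y = d] by (simp add: mult.commute)
    then show ?thesis
      by (simp add: g_def flip: sum_distrib_left)
  qed
  have "balanced_sum n a c d e f = (\<Sum>k\<le>n. \<Sum>j\<le>n - k. g k j)"
    unfolding balanced_sum_def by (rule sum.cong[OF refl], rule expand) simp
  also have "\<dots> = (\<Sum>(k, j)\<in>{(k, j). k + j \<le> n}. g k j)"
  proof -
    have "{(k, j). k + j \<le> n} = (SIGMA k:{..n}. {..n - k})"
      by auto
    then show ?thesis
      by (simp add: sum.Sigma)
  qed
  also have "\<dots> = (\<Sum>N\<le>n. \<Sum>k\<le>N. g k (N - k))"
    by (rule sum.triangle_reindex_eq)
  finally show ?thesis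
    by (simp add: collapse R_def mult_ac)
qed

lemma balanced_sum_exchange:
  assumes "c \<noteq> 0" "d \<noteq> 0" "e \<noteq> 0" "f \<noteq> 0"
  shows "balanced_sum n a c d e f = balanced_sum n a d e c f"
  using assms by (simp add: balanced_sum_alt mult_ac)

text \<open>
  Reversing both \<open>(a/(cd); q)\<^sub>n\<close> and \<open>(q; q)\<^sub>n\<close> turns the quotient of \<open>(q\<^sup>-\<^sup>n; q)\<^sub>k\<close> by the denominator
  symbol \<open>(q\<^sup>-\<^sup>ncd/b; q)\<^sub>k\<close> into a polynomial and a \<open>q\<close>-binomial coefficient.
\<close>

lemma phi43_eq_balanced_sum:
  assumes "b \<noteq> 0" "c \<noteq> 0" "d \<noteq> 0" "q \<noteq> 0"
    and ok: "denom_ok q n (q powi (- int n) * c * d / b)"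
      "denom_ok q n (q * b / e)" "denom_ok q n (q * b / f)"
  shows "qpochs [q * b / (c * d), q * b / e, q * b / f] q n
      * phi43 n (q * b / (e * f)) c d (q powi (- int n) * c * d / b) (q * b / e) (q * b / f) q q
    = balanced_sum n (q * b) c d e f"
proof -
  define A \<delta> where "A = q * b / (c * d)" and "\<delta> = q powi (- int n) * c * d / b"
  have "A \<noteq> 0" and \<delta>: "q powi (- int n) * q / A = \<delta>"
    using assms by (simp_all add: A_def \<delta>_def field_simps)
  have "qpochs [A, q * b / e, q * b / f] q n
      * (qpochs [q powi (- int n), q * b / (e * f), c, d] q k
         / qpochs [q, \<delta>, q * b / e, q * b / f] q k * q ^ k)
    = qbinomial q n k * A ^ k * qpoch (q * b / (e * f)) q k * qpoch c q k * qpoch d q k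
       * qpoch A q (n - k) * qpoch (q * b / e * q ^ k) q (n - k)
       * qpoch (q * b / f * q ^ k) q (n - k)" if "k \<le> n" for k
  proof -
    define w where "w = (\<Prod>i<k. - (q ^ (n - 1 - i)))"
    have nz: "qpoch q q i \<noteq> 0" for i
      using qpoch_q_nonzero[OF nonroot] .
    have "qpoch \<delta> q k \<noteq> 0" "qpoch (q * b / e) q k \<noteq> 0" "qpoch (q * b / f) q k \<noteq> 0"
      using ok qpoch_nonzero_if_denom_ok \<open>q \<noteq> 0\<close> \<open>k \<le> n\<close> by (auto simp: \<delta>_def)
    note nz = nz this
    have split: "qpoch x q n = qpoch x q k * qpoch (x * q ^ k) q (n - k)" for x
      using qpoch_add[of x q k "n - k"] \<open>k \<le> n\<close> by simp
    have "qpoch A q n = qpoch A q (n - k) * A ^ k * w * qpoch \<delta> q k"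
      using qpoch_reverse[OF \<open>q \<noteq> 0\<close> \<open>A \<noteq> 0\<close> \<open>k \<le> n\<close>] by (simp add: w_def \<delta>)
    moreover have "qbinomial q n k = w * qpoch (q powi (- int n)) q k * q ^ k / qpoch q q k"
      using qpoch_reverse[OF \<open>q \<noteq> 0\<close> \<open>q \<noteq> 0\<close> \<open>k \<le> n\<close>] \<open>q \<noteq> 0\<close> \<open>k \<le> n\<close> nz
      by (simp add: w_def qbinomial_def)
    ultimately show ?thesis
      using nz by (simp add: qpochs_def split[of "q * b / e"] split[of "q * b / f"])
  qed
  then show ?thesis
    by (simp add: phi43_def balanced_sum_def sum_distrib_left flip: A_def \<delta>_def)
qed

end

section \<open>The transformations\<close>

theorem corollary3p8:
  fixes n :: nat and b c d e f q :: complex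
  assumes "b \<noteq> 0" "c \<noteq> 0" "d \<noteq> 0" "e \<noteq> 0" "f \<noteq> 0" "q \<noteq> 0" "cmod q \<noteq> 1"
    and series_denominators:
      "\<forall>x \<in> {q*b/c, q*b/d, q*b/e, q*b/f,
              q powi (- int n) * c*d/b, q powi (- int n) * d*e/b, q powi (- int n) * d*f/b,
              q powi (- int n) * c*e/b, q powi (- int n) * c*f/b, q powi (- int n) * e*f/b}.
         denom_ok q n x"
    and prefactor_denominators: "qpochs [q*b/(c*d), q*b/e, q*b/f] q n \<noteq> 0"
  shows
    "phi43 n (q*b/(e*f)) c d (q powi (- int n) * c*d/b) (q*b/e) (q*b/f) q q
       = qpochs [q*b/(d*e), q*b/c] q n / qpochs [q*b/(c*d), q*b/e] q n
         * phi43 n (q*b/(c*f)) d e (q powi (- int n) * d*e/b) (q*b/c) (q*b/f) q q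
   \<and> phi43 n (q*b/(e*f)) c d (q powi (- int n) * c*d/b) (q*b/e) (q*b/f) q q
       = qpochs [q*b/(d*f), q*b/c] q n / qpochs [q*b/(c*d), q*b/f] q n
         * phi43 n (q*b/(c*e)) d f (q powi (- int n) * d*f/b) (q*b/c) (q*b/e) q q
   \<and> phi43 n (q*b/(e*f)) c d (q powi (- int n) * c*d/b) (q*b/e) (q*b/f) q q
       = qpochs [q*b/(c*e), q*b/d] q n / qpochs [q*b/(c*d), q*b/e] q n
         * phi43 n (q*b/(d*f)) c e (q powi (- int n) * c*e/b) (q*b/d) (q*b/f) q q
   \<and> phi43 n (q*b/(e*f)) c d (q powi (- int n) * c*d/b) (q*b/e) (q*b/f) q q
       = qpochs [q*b/(c*f), q*b/d] q n / qpochs [q*b/(c*d), q*b/f] q n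
         * phi43 n (q*b/(d*e)) c f (q powi (- int n) * c*f/b) (q*b/d) (q*b/e) q q
   \<and> phi43 n (q*b/(e*f)) c d (q powi (- int n) * c*d/b) (q*b/e) (q*b/f) q q
       = qpochs [q*b/(e*f), q*b/c, q*b/d] q n / qpochs [q*b/(c*d), q*b/e, q*b/f] q n
         * phi43 n (q*b/(c*d)) e f (q powi (- int n) * e*f/b) (q*b/c) (q*b/d) q q"
proof -
  have nonroot: "q ^ m \<noteq> 1" if "m > 0" for m
  proof
    assume "q ^ m = 1"
    then have "cmod q ^ m = 1"
      by (metis norm_one norm_power)
    with \<open>m > 0\<close> \<open>cmod q \<noteq> 1\<close> show False
      using power_eq_imp_eq_base[of "cmod q" m 1] by simp
  qed
  note nz = \<open>b \<noteq> 0\<close> \<open>c \<noteq> 0\<close> \<open>d \<noteq> 0\<close> \<open>e \<noteq> 0\<close> \<open>f \<noteq> 0\<close> \<open>q \<noteq> 0\<close>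
  define S where "S = balanced_sum q n (q * b)"
  have left: "S u v w x = S v u w x" and right: "S u v w x = S u v x w" for u v w x
    unfolding S_def using nonroot balanced_sum_swap_left balanced_sum_swap_right by blast+
  have exchange: "S u v w x = S v w u x" if "u \<noteq> 0" "v \<noteq> 0" "w \<noteq> 0" "x \<noteq> 0" for u v w x
    unfolding S_def using nonroot that by (rule balanced_sum_exchange)
  have de: "S c d e f = S d e c f"
    using nz by (intro exchange)
  have df: "S c d e f = S d f c e"
    using nz by (subst right) (intro exchange)
  have ce: "S c d e f = S c e d f"
    using nz by (subst left) (intro exchange)
  have cf: "S c d e f = S c f d e"
    using nz by (subst left, subst right) (intro exchange)
  have ef: "S c d e f = S e f c d"
    using nz by (metis exchange right)

  let ?p = "\<lambda>u v w x. qpochs [q*b/(u*v), q*b/w, q*b/x] q n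
    * phi43 n (q*b/(w*x)) u v (q powi (- int n) * u*v/b) (q*b/w) (q*b/x) q q"
  have phi: "?p u v w x = S u v w x"
    if "u \<noteq> 0" "v \<noteq> 0" "denom_ok q n (q powi (- int n) * u*v/b)"
      "denom_ok q n (q*b/w)" "denom_ok q n (q*b/x)" for u v w x
    unfolding S_def using nonroot nz(1) that(1,2) nz(6) that(3-5) by (rule phi43_eq_balanced_sum)
  have cd_eq: "?p c d e f = S c d e f"
    using nz series_denominators by (intro phi) simp_all
  have de_eq: "?p c d e f = ?p d e c f"
    unfolding cd_eq de using nz series_denominators by (intro phi[symmetric]) simp_all
  have df_eq: "?p c d e f = ?p d f c e"
    unfolding cd_eq df using nz series_denominators by (intro phi[symmetric]) simp_all
  have ce_eq: "?p c d e f = ?p c e d f"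
    unfolding cd_eq ce using nz series_denominators by (intro phi[symmetric]) simp_all
  have cf_eq: "?p c d e f = ?p c f d e"
    unfolding cd_eq cf using nz series_denominators by (intro phi[symmetric]) simp_all
  have ef_eq: "?p c d e f = ?p e f c d"
    unfolding cd_eq ef using nz series_denominators by (intro phi[symmetric]) simp_all
  have pre: "qpoch (q*b/(c*d)) q n \<noteq> 0" "qpoch (q*b/e) q n \<noteq> 0" "qpoch (q*b/f) q n \<noteq> 0"
    using prefactor_denominators by (auto simp: qpochs_def)
  show ?thesis
    using de_eq df_eq ce_eq cf_eq ef_eq pre
    by (intro conjI) (simp_all add: qpochs_def nonzero_eq_divide_eq eq_divide_eq mult_ac)
qed

end
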